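(* Let $X$ be a finite set with $n\geq 2$ elements and let $m=\lfloor n/2\rfloor$. Then: (1) If $n<10$, then the clique number of the commuting graph of $\mathcal{I}(X)$ is $2^n-2$. (2) If $n\geq 10$, then the clique number of the commuting graph of $\mathcal{I}(X)$ is $$\lambda_n-1=\sum_{r=0}^m\binom{m}{r}\binom{n-m}{r}r!-1.$$
   Context: For a finite set $X$, $\mathcal{I}(X)$ is the symmetric inverse semigroup on $X$: all partial injective transformations of $X$ (injective functions whose domain and image are subsets of $X$) under composition of partial functions. The commuting graph of a finite non-commutative semigroup $S$ is the simple graph whose vertices are the elements of $S$ not in the center $Z(S)=\{a\in S: ab=ba\text{ for all }b\in S\}$, two distinct vertices $a,b$ being adjacent iff $ab=ba$. The clique number of a graph is the largest cardinality of a set of pairwise adjacent vertices. Here $\lambda_n=\sum_{r=0}^{m}\binom{m}{r}\binom{n-m}{r}r!$ with $m=\lfloor n/2\rfloor$. *)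

theory Defs
  imports "HOL-Algebra.Group" "HOL-Library.Ramsey"
begin

text \<open>
  The symmetric inverse semigroup on \<open>X\<close>. Its elements are the partial injective
  transformations of \<open>X\<close>, represented as maps \<open>'a \<rightharpoonup> 'a\<close> with domain and range inside \<open>X\<close>. The
  semigroup happens to have an identity, the identity function on \<open>X\<close>, so the \<open>monoid\<close>
  record of HOL-Algebra is used as the carrier structure.
\<close>

definition sym_inv_semigroup :: "'a set \<Rightarrow> ('a \<rightharpoonup> 'a) monoid"
  where "sym_inv_semigroup X =
    \<lparr>carrier = {f. dom f \<subseteq> X \<and> ran f \<subseteq> X \<and> inj_on f (dom f)},
     mult = (\<lambda>f g. f \<circ>\<^sub>m g),
     one = Some |` X\<rparr>"

lemma monoid_sym_inv_semigroup: "monoid (sym_inv_semigroup X)"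
proof (rule monoidI, goal_cases)
  case (1 f g)
  then have f: "dom f \<subseteq> X" "ran f \<subseteq> X" "inj_on f (dom f)"
    and g: "dom g \<subseteq> X" "ran g \<subseteq> X" "inj_on g (dom g)"
    by (auto simp: sym_inv_semigroup_def)
  have "inj_on (f \<circ>\<^sub>m g) (dom (f \<circ>\<^sub>m g))"
  proof (rule inj_onI)
    fix x y assume x: "x \<in> dom (f \<circ>\<^sub>m g)" and eq: "(f \<circ>\<^sub>m g) x = (f \<circ>\<^sub>m g) y"
    from x obtain z where z: "(f \<circ>\<^sub>m g) x = Some z" by auto
    then obtain u where u: "g x = Some u" "f u = Some z" by (auto simp: map_comp_Some_iff)
    from z eq obtain v where v: "g y = Some v" "f v = Some z" by (auto simp: map_comp_Some_iff)
    from f(3) u(2) v(2) have "u = v" by (metis domI inj_onD)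
    with g(3) u(1) v(1) show "x = y" by (metis domI inj_onD)
  qed
  moreover have "dom (f \<circ>\<^sub>m g) \<subseteq> X" "ran (f \<circ>\<^sub>m g) \<subseteq> X"
    using f(2) g(1) by (fastforce simp: map_comp_Some_iff ran_def dom_def)+
  ultimately show ?case by (simp add: sym_inv_semigroup_def)
next
  case 2
  then show ?case
    by (auto simp: sym_inv_semigroup_def ran_def restrict_map_def inj_on_def split: if_splits)
next
  case (3 f g h)
  then show ?case
    by (auto simp: sym_inv_semigroup_def map_comp_def split: option.splits)
next
  case (4 f)
  then show ?case
    by (fastforce simp: sym_inv_semigroup_def map_comp_def restrict_map_def ran_def
        split: option.splits)
next
  case (5 f)
  then have "dom f \<subseteq> X" by (simp add: sym_inv_semigroup_def)
  then have "f \<circ>\<^sub>m (Some |` X) = f"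
    by (intro ext) (auto simp: map_comp_def restrict_map_def, metis domIff subsetD)
  then show ?case by (simp add: sym_inv_semigroup_def)
qed

definition semigroup_center :: "('s, 'm) monoid_scheme \<Rightarrow> 's set"
  where "semigroup_center S =
    {a \<in> carrier S. \<forall>b \<in> carrier S. a \<otimes>\<^bsub>S\<^esub> b = b \<otimes>\<^bsub>S\<^esub> a}"

text \<open>
  A simple graph is a pair of a set of vertices and a set of two-element sets of vertices, so that
  the notion of clique from \<open>HOL-Library.Ramsey\<close> applies.
\<close>

definition commuting_graph :: "('s, 'm) monoid_scheme \<Rightarrow> 's set \<times> 's set set"
  where "commuting_graph S =
    (let V = carrier S - semigroup_center S
     in (V, {{a, b} | a b. a \<in> V \<and> b \<in> V \<and> a \<noteq> b \<and> a \<otimes>\<^bsub>S\<^esub> b = b \<otimes>\<^bsub>S\<^esub> a}))"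

text \<open>The maximum is meaningful because it is only used for graphs with finitely many vertices.\<close>

definition clique_number :: "'v set \<times> 'v set set \<Rightarrow> nat"
  where "clique_number G = Max (card ` {K. K \<subseteq> fst G \<and> clique K (snd G)})"

definition lambda_num :: "nat \<Rightarrow> nat"
  where "lambda_num n =
    (let m = n div 2 in \<Sum>r = 0..m. (m choose r) * ((n - m) choose r) * fact r)"

end

(*
  A set of commuting partial injections is enlarged to a maximal one, S, which is a monoid. If S
  contains an idempotent with domain D other than the empty set and X, then S preserves D and X - D,
  and the bound follows by induction from the supermultiplicativity of
  n |-> max (2^n) (lambda_n + 1). Otherwise every element of S is a permutation or nilpotent.
  Preorder X by "y = f x for some f in S", and pick a set A of representatives of the minimal
  classes; by commutativity, f is determined by its restriction to A. A permutation preserves every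
  minimal class, and a nilpotent element maps A partially and injectively to the set Y of
  non-minimal points. The number of such partial injections depends only on |A| and |Y|, and is
  largest when |A| and |Y| are balanced.
*)
theory Submission
  imports Defs
begin

section \<open>Counting partial injections\<close>

text \<open>Separate source and target sets let one notion serve both the carrier, with source and
  target \<open>X\<close>, and the maps from representatives to non-minimal points counted
  later.\<close>

definition part_inj :: "'a set \<Rightarrow> 'b set \<Rightarrow> ('a \<rightharpoonup> 'b) set"
  where "part_inj A B = {f. dom f \<subseteq> A \<and> ran f \<subseteq> B \<and> inj_on f (dom f)}"

lemma part_injD:
  assumes "f \<in> part_inj A B" "f x = Some y"
  shows "x \<in> A" "y \<in> B"
  using assms by (auto simp: part_inj_def ran_def)

lemma part_inj_injD:
  assumes "f \<in> part_inj A B" "f x = Some z" "f y = Some z"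
  shows "x = y"
  using assms by (auto simp: part_inj_def inj_on_def dom_def)

lemma part_injI:
  assumes "\<And>x y. f x = Some y \<Longrightarrow> x \<in> A \<and> y \<in> B"
    and "\<And>x y z. f x = Some z \<Longrightarrow> f y = Some z \<Longrightarrow> x = y"
  shows "f \<in> part_inj A B"
  using assms by (fastforce simp: part_inj_def ran_def inj_on_def dom_def)

lemma part_inj_eqI:
  assumes "f \<in> part_inj A B" "g \<in> part_inj A B" "\<And>x. x \<in> A \<Longrightarrow> f x = g x"
  shows "f = g"
proof
  fix x
  show "f x = g x"
    using assms(3)[of x] part_injD(1)[OF assms(1)] part_injD(1)[OF assms(2)]
    by (cases "x \<in> A") (metis option.exhaust)+
qed

lemma part_inj_restrict:
  assumes "f \<in> part_inj X Y" "\<And>x y. x \<in> A \<Longrightarrow> f x = Some y \<Longrightarrow> y \<in> B"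
  shows "f |` A \<in> part_inj A B"
proof (rule part_injI)
  show "x \<in> A \<and> y \<in> B" if "(f |` A) x = Some y" for x y
    using that assms(2) by (auto simp: restrict_map_def split: if_splits)
  show "x = y" if "(f |` A) x = Some z" "(f |` A) y = Some z" for x y z
    using that part_inj_injD[OF assms(1)] by (auto simp: restrict_map_def split: if_splits)
qed

lemma part_inj_idem: "D \<subseteq> X \<Longrightarrow> Some |` D \<in> part_inj X X"
  by (rule part_injI) (auto simp: restrict_map_def split: if_splits)

lemma part_inj_id_comm:
  assumes "f \<in> part_inj X X"
  shows "Some |` X \<circ>\<^sub>m f = f \<circ>\<^sub>m Some |` X"
proof
  fix x show "(Some |` X \<circ>\<^sub>m f) x = (f \<circ>\<^sub>m Some |` X) x"
    using part_injD[OF assms, of x]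
    by (cases "f x") (auto simp: map_comp_def restrict_map_def)
qed

lemma part_inj_comp:
  assumes "f \<in> part_inj X X" "g \<in> part_inj X X"
  shows "f \<circ>\<^sub>m g \<in> part_inj X X"
proof (rule part_injI)
  show "x \<in> X \<and> y \<in> X" if "(f \<circ>\<^sub>m g) x = Some y" for x y
    using that part_injD[OF assms(1)] part_injD[OF assms(2)] by (auto simp: map_comp_Some_iff)
  show "x = y" if "(f \<circ>\<^sub>m g) x = Some z" "(f \<circ>\<^sub>m g) y = Some z" for x y z
    using that part_inj_injD[OF assms(1)] part_inj_injD[OF assms(2)]
    by (auto simp: map_comp_Some_iff)
qed

text \<open>The number of placements of non-attacking rooks on an \<open>a \<times> b\<close> board.\<close>

fun rook :: "nat \<Rightarrow> nat \<Rightarrow> nat" where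
  "rook 0 b = 1"
| "rook (Suc a) b = rook a b + b * rook a (b - 1)"

text \<open>Either \<open>f\<close> is undefined at \<open>p\<close>, or it takes a value
  \<open>q\<close> there that injectivity then forbids elsewhere. These are the two summands in the
  recursion for \<open>rook\<close>.\<close>

lemma part_inj_insert:
  assumes "p \<notin> A"
  shows "part_inj (insert p A) B =
    part_inj A B \<union> (\<Union>q\<in>B. (\<lambda>g. g(p \<mapsto> q)) ` part_inj A (B - {q}))" (is "?L = ?R")
proof (intro subset_antisym subsetI)
  fix f assume f: "f \<in> ?L"
  show "f \<in> ?R"
  proof (cases "f p")
    case None
    have "f \<in> part_inj A B"
    proof (rule part_injI)
      show "x \<in> A \<and> y \<in> B" if "f x = Some y" for x y
        using part_injD[OF f that] that None by auto
    qed (rule part_inj_injD[OF f])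
    then show ?thesis by simp
  next
    case (Some q)
    have "f(p := None) \<in> part_inj A (B - {q})"
    proof (rule part_injI)
      show "x \<in> A \<and> y \<in> B - {q}" if "(f(p := None)) x = Some y" for x y
        using part_injD[OF f, of x y] part_inj_injD[OF f Some, of x] that
        by (auto split: if_splits)
      show "x = y" if "(f(p := None)) x = Some z" "(f(p := None)) y = Some z" for x y z
        using part_inj_injD[OF f] that by (auto split: if_splits)
    qed
    moreover have "f = (f(p := None))(p \<mapsto> q)" using Some by auto
    moreover have "q \<in> B" using part_injD[OF f Some] by simp
    ultimately show ?thesis by blast
  qed
next
  fix f assume "f \<in> ?R"
  then consider "f \<in> part_inj A B" | q g where "q \<in> B" "g \<in> part_inj A (B - {q})" "f = g(p \<mapsto> q)"
    by blast
  then show "f \<in> ?L"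
  proof cases
    case 1
    then show ?thesis by (auto simp: part_inj_def)
  next
    case 2
    show ?thesis
    proof (rule part_injI)
      show "x \<in> insert p A \<and> y \<in> B" if "f x = Some y" for x y
        using part_injD[OF 2(2), of x y] that 2 by (auto split: if_splits)
      show "x = y" if "f x = Some z" "f y = Some z" for x y z
        using part_injD[OF 2(2), of x z] part_injD[OF 2(2), of y z] part_inj_injD[OF 2(2), of x z y]
          that 2 by (auto split: if_splits)
    qed
  qed
qed

lemma card_part_inj:
  assumes "finite A" "finite B"
  shows "finite (part_inj A B) \<and> card (part_inj A B) = rook (card A) (card B)"
  using assms
proof (induction A arbitrary: B rule: finite_induct)
  case empty
  have "part_inj {} B = {Map.empty}" by (auto simp: part_inj_def)
  then show ?case by (metis card_1_singleton_iff card.empty finite.intros One_nat_def rook.simps(1))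
next
  case (insert p A)
  let ?F = "\<lambda>q. (\<lambda>g. g(p \<mapsto> q)) ` part_inj A (B - {q})"
  have np: "g p = None" if "g \<in> part_inj A C" for g :: "'a \<rightharpoonup> 'b" and C
    using that insert.hyps(2) by (auto simp: part_inj_def)
  have fin: "finite (?F q)" for q using insert by auto
  have card: "card (?F q) = rook (card A) (card B - 1)" if "q \<in> B" for q
  proof -
    have "inj_on (\<lambda>g. g(p \<mapsto> q)) (part_inj A (B - {q}))"
    proof (rule inj_onI)
      fix g h assume gh: "g \<in> part_inj A (B - {q})" "h \<in> part_inj A (B - {q})"
        "g(p \<mapsto> q) = h(p \<mapsto> q)"
      show "g = h"
      proof
        fix x show "g x = h x"
          using fun_cong[OF gh(3), of x] np[OF gh(1)] np[OF gh(2)] by (cases "x = p") auto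
      qed
    qed
    then show ?thesis using insert that by (simp add: card_image)
  qed
  have "card (\<Union>q\<in>B. ?F q) = (\<Sum>q\<in>B. card (?F q))"
  proof (rule card_UN_disjoint)
    show "\<forall>q\<in>B. \<forall>q'\<in>B. q \<noteq> q' \<longrightarrow> ?F q \<inter> ?F q' = {}"
      by (auto dest!: fun_cong[where x = p])
  qed (use insert fin in auto)
  then have c: "card (\<Union>q\<in>B. ?F q) = card B * rook (card A) (card B - 1)"
    using card by simp
  have "part_inj A B \<inter> (\<Union>q\<in>B. ?F q) = {}"
    using np by fastforce
  then show ?case
    unfolding part_inj_insert[OF insert.hyps(2)]
    using insert fin c by (subst card_Un_disjoint) auto
qed

text \<open>The \<open>r\<close>-th term counts placements of exactly \<open>r\<close> rooks.
  Pascal's rule in \<open>a\<close> and absorption in \<open>b\<close> reproduce the recursion.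
  Leaving \<open>N\<close> free lets \<open>rook a b\<close> and \<open>rook b a\<close> share one
  summation range, which makes the symmetry visible.\<close>

lemma rook_eq_sum:
  assumes "a \<le> N"
  shows "rook a b = (\<Sum>r\<le>N. (a choose r) * (b choose r) * fact r)"
  using assms
proof (induction a arbitrary: b N)
  case 0
  have "(\<Sum>r\<le>N. (0 choose r) * (b choose r) * fact r) =
      (\<Sum>r\<in>{0}. (0 choose r) * (b choose r) * fact r :: nat)"
    by (rule sum.mono_neutral_right) auto
  then show ?case by simp
next
  case (Suc a)
  then obtain M where N: "N = Suc M" and M: "a \<le> M" by (cases N) auto
  have *: "(b choose Suc r) * fact (Suc r) = b * ((b - 1 choose r) * fact r)" for r
  proof -
    have "(b choose Suc r) * fact (Suc r) = Suc r * (b choose Suc r) * fact r"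
      by (simp add: algebra_simps)
    also have "\<dots> = b * (b - 1 choose r) * fact r"
      using times_binomial_minus1_eq[of "Suc r" b] by simp
    finally show ?thesis by simp
  qed
  have "(\<Sum>r\<le>N. (Suc a choose r) * (b choose r) * fact r) =
      1 + (\<Sum>r\<le>M. (a choose Suc r) * (b choose Suc r) * fact (Suc r)) +
        (\<Sum>r\<le>M. (a choose r) * ((b choose Suc r) * fact (Suc r)))"
    unfolding N sum.atMost_Suc_shift
    by (simp add: sum.distrib[symmetric] algebra_simps del: fact_Suc)
  also have "1 + (\<Sum>r\<le>M. (a choose Suc r) * (b choose Suc r) * fact (Suc r)) = rook a b"
    unfolding Suc.IH[of N b, OF Suc_leD[OF Suc.prems]] N sum.atMost_Suc_shift by simp
  also have "(\<Sum>r\<le>M. (a choose r) * ((b choose Suc r) * fact (Suc r))) = b * rook a (b - 1)"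
    unfolding * Suc.IH[OF M, of "b - 1"] by (simp add: sum_distrib_left algebra_simps)
  finally show ?case by simp
qed

section \<open>Symmetry and inequalities for rook numbers\<close>

lemma rook_commute: "rook a b = rook b a"
  by (simp add: rook_eq_sum[of a "max a b"] rook_eq_sum[of b "max a b"] mult.commute)

lemma rook_Suc_right: "rook a (Suc b) = rook a b + a * rook (a - 1) b"
  by (metis rook.simps(2) rook_commute)

lemma rook_pos: "rook a b > 0"
  by (induction a) auto

lemma rook_mono:
  assumes "a \<le> a'" "b \<le> b'"
  shows "rook a b \<le> rook a' b'"
proof -
  have left: "rook c d \<le> rook c' d" if "c \<le> c'" for c c' d
    using that by (induction c' rule: dec_induct) auto
  have "rook a b \<le> rook a' b" by (rule left) fact
  also have "\<dots> \<le> rook a' b'" using left[OF assms(2), of a'] by (simp add: rook_commute)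
  finally show ?thesis .
qed

text \<open>Placements on two diagonal blocks of a large board combine into a placement on the whole
  board. The induction compares the two recursions term by term.\<close>

lemma rook_supermult: "rook a b * rook c d \<le> rook (a + c) (b + d)"
proof (induction c arbitrary: d)
  case 0
  then show ?case by (simp add: rook_mono)
next
  case (Suc c)
  have "d * (rook a b * rook c (d - 1)) \<le> (b + d) * rook (a + c) (b + d - 1)"
  proof (cases d)
    case (Suc d')
    then show ?thesis using Suc.IH[of d'] by (intro mult_mono) auto
  qed simp
  then show ?case using Suc.IH[of d] by (simp add: algebra_simps)
qed

text \<open>Expand one row of the second block: of its \<open>b + d\<close> columns,
  \<open>d\<close> account for the product of the rook numbers, and the remaining
  \<open>b \<ge> 2\<close> columns pay for the two cross terms \<open>rook a b\<close> and
  \<open>rook c d\<close>, each at most \<open>?R\<close>.\<close>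

lemma rook_supermult_plus1:
  assumes "a \<ge> 1" "b \<ge> 2" "c \<ge> 1" "d \<ge> 1"
  shows "(rook a b + 1) * (rook c d + 1) \<le> rook (a + c) (b + d) + 1"
proof -
  obtain c' d' where cd: "c = Suc c'" "d = Suc d'"
    using assms by (metis Suc_le_D One_nat_def)
  let ?R = "rook (a + c') (b + d')"
  have "rook a b * rook c' d \<le> rook (a + c') (b + d)"
    and "rook a b * rook c' d' \<le> ?R" by (rule rook_supermult)+
  then have *: "rook a b * rook c d \<le> rook (a + c') (b + d) + d * ?R"
    using mult_le_mono2[of "rook a b * rook c' d'" ?R d] by (simp add: cd algebra_simps)
  moreover have "rook (a + c) (b + d) = rook (a + c') (b + d) + d * ?R + b * ?R"
    by (simp add: cd algebra_simps)
  moreover have "2 * ?R \<le> b * ?R" using assms(2) by (rule mult_le_mono1)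
  moreover have "rook a b \<le> ?R" by (rule rook_mono) auto
  moreover have "rook c d \<le> ?R" by (rule rook_mono) (use assms cd in auto)
  ultimately have "rook a b * rook c d + rook a b + rook c d \<le> rook (a + c) (b + d)"
    using * by linarith
  then show ?thesis by simp
qed

text \<open>Expanding the left board by a row and the right one by a column leaves the common
  summand \<open>rook a b\<close>. The remaining products are compared factor by factor, using the
  induction hypothesis.\<close>

lemma rook_balance: "b \<le> a \<Longrightarrow> rook (Suc a) b \<le> rook a (Suc b)"
proof (induction b arbitrary: a)
  case 0
  then show ?case by (simp add: rook_commute[of "Suc a"] rook_commute[of a])
next
  case (Suc b)
  then obtain a' where a: "a = Suc a'" by (cases a) auto
  have "Suc b * rook a b \<le> a * rook a' (Suc b)"
    using Suc.IH[of a'] Suc.prems a by (intro mult_mono) auto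
  then show ?case unfolding rook_Suc_right[of a "Suc b"] by (simp add: a)
qed

section \<open>Growth of the extremal function\<close>

lemma lambda_num_eq_rook: "lambda_num n = rook (n div 2) (n - n div 2)"
  by (simp add: lambda_num_def Let_def rook_eq_sum[OF order_refl] atLeast0AtMost)

text \<open>Moving one line at a time from the longer side to the shorter never decreases the count,
  and it ends at side lengths differing by at most 1, the board of
  \<open>lambda_num\<close>.\<close>

lemma rook_le_lambda_num: "rook a b \<le> lambda_num (a + b)"
proof -
  have *: "rook a b \<le> lambda_num (a + b)" if "b \<le> a" for a b
    using that
  proof (induction "a - b" arbitrary: a b rule: less_induct)
    case less
    consider "a = b" | "a = Suc b" | a' where "a = Suc a'" "Suc b \<le> a'"
      using less.prems by (cases a; force)
    then show ?case
    proof cases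
      case 1
      then show ?thesis by (simp add: lambda_num_eq_rook flip: mult_2)
    next
      case 2
      have "(a + b) div 2 = b" "a + b - (a + b) div 2 = a" using 2 by auto
      then show ?thesis by (simp add: lambda_num_eq_rook rook_commute)
    next
      case 3
      have "rook a b \<le> rook a' (Suc b)" using 3 rook_balance by simp
      also have "\<dots> \<le> lambda_num (a' + Suc b)" by (rule less.hyps) (use 3 in auto)
      finally show ?thesis using 3 by simp
    qed
  qed
  show ?thesis
    using *[of a b] *[of b a] by (cases "b \<le> a") (auto simp: rook_commute add.commute)
qed

text \<open>The board for \<open>Suc n\<close> has one more line than the one for \<open>n\<close>,
  so its count is \<open>lambda_num n\<close> plus the placements with a rook in that line. It
  remains to show that these number at least \<open>lambda_num n + 1\<close>.\<close>

lemma lambda_num_double: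
  assumes "n \<ge> 10"
  shows "2 * (lambda_num n + 1) \<le> lambda_num (Suc n) + 1"
proof (cases "even n")
  case True
  then obtain k where n: "n = 2 * k" by auto
  then have "k \<ge> 5" using assms by auto
  then obtain m where k: "k = Suc (Suc m)" and m: "m \<ge> 3"
    by (intro that[of "k - 2"]) auto
  have l: "lambda_num n = rook k k" "lambda_num (Suc n) = rook (Suc k) k"
    by (simp_all add: n lambda_num_eq_rook rook_commute[of "Suc k"] del: rook.simps)
  \<comment> \<open>Expanding both sides of the goal down to this board and cancelling leaves
    \<open>rook (Suc m) (Suc m) + 1 \<le> (m + 1) * (m + 1) * ?x\<close>.\<close>
  let ?x = "rook (Suc m) m"
  have x: "rook (Suc m) (Suc m) \<le> (m + 2) * ?x"
    using mult_le_mono2[OF rook_mono[of m "Suc m" m m], of "Suc m"]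
    by (simp add: rook_Suc_right algebra_simps del: rook.simps)
  have "(m + 2) + 1 \<le> (m + 1) * (m + 1)" using m by (simp add: algebra_simps)
  then have "((m + 2) + 1) * ?x \<le> (m + 1) * (m + 1) * ?x" by (rule mult_le_mono1)
  moreover have "?x > 0" by (rule rook_pos)
  ultimately have y: "rook (Suc m) (Suc m) + 1 \<le> (m + 1) * (m + 1) * ?x"
    using x by (simp add: algebra_simps del: rook.simps)
  have r: "rook k (Suc m) = rook (Suc m) (Suc m) + Suc m * ?x" by (simp add: k)
  have "rook k k + 1 \<le> k * rook k (Suc m)"
  proof -
    have "rook k k = rook k (Suc m) + k * rook (Suc m) (Suc m)"
      using rook_Suc_right[of k "Suc m"] unfolding k by simp
    then show ?thesis using r y by (simp add: k algebra_simps del: rook.simps)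
  qed
  moreover have "rook (Suc k) k = rook k k + k * rook k (Suc m)" by (simp add: k)
  ultimately show ?thesis unfolding l by (simp only: distrib_left)
next
  case False
  then obtain k where n: "n = Suc (2 * k)" by (auto elim: oddE)
  obtain m where k: "k = Suc m" using n assms by (cases k) auto
  have l: "lambda_num n = rook k (Suc k)" "lambda_num (Suc n) = rook (Suc k) (Suc k)"
    by (simp_all add: n lambda_num_eq_rook Suc_diff_le)
  have "rook k k \<ge> rook m k + 1"
    using rook_pos[of m m] by (simp add: k)
  then have "k * (rook m k + 1) \<le> k * rook k k" by (rule mult_le_mono2)
  then have "rook k (Suc k) + 1 \<le> Suc k * rook k k"
    unfolding rook_Suc_right by (simp add: k algebra_simps)
  then show ?thesis unfolding l by simp
qed

text \<open>For \<open>n \<ge> 1\<close> this is the maximum of \<open>2 ^ n\<close>, the number of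
  idempotents, and \<open>lambda_num n + 1\<close>, the size of a null semigroup of maps from one
  half to the other with the identity adjoined. The order flips between 9, where the values are 512
  and 502, and 10, where they are 1024 and 1547.\<close>

definition extremal :: "nat \<Rightarrow> nat"
  where "extremal n = (if n < 10 then 2 ^ n else lambda_num n + 1)"

lemma extremal_double:
  assumes "n \<ge> 1"
  shows "2 * extremal n \<le> extremal (Suc n)"
proof -
  \<comment> \<open>The only doubling step across the threshold compares 1024 with 1547.\<close>
  have "lambda_num 10 = 1546" by code_simp
  then have nine: "2 * extremal 9 \<le> extremal (Suc 9)" by (simp add: extremal_def)
  consider "n < 9" | "n = 9" | "n \<ge> 10" by linarith
  then show ?thesis
  proof cases
    case 2
    show ?thesis unfolding 2 by (rule nine)
  qed (use lambda_num_double[of n] in \<open>simp_all add: extremal_def\<close>)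
qed

lemma power2_mult_extremal:
  assumes "n \<ge> 1"
  shows "2 ^ k * extremal n \<le> extremal (k + n)"
proof (induction k)
  case (Suc k)
  then show ?case using extremal_double[of "k + n"] assms by simp
qed simp

lemma lambda_num_le_extremal:
  assumes "n \<ge> 1"
  shows "lambda_num n + 1 \<le> extremal n"
proof (cases "n < 10")
  case True
  have "\<forall>n \<in> set [1..<10]. lambda_num n + 1 \<le> 2 ^ n" by code_simp
  then show ?thesis using True assms by (simp add: extremal_def)
qed (simp add: extremal_def)

text \<open>If one factor is a power of two, repeated doubling suffices. Otherwise the two balanced
  boards are joined diagonally; the joint board may be off balance when both sizes are odd, so
  \<open>rook_le_lambda_num\<close> rebalances it.\<close>

lemma extremal_supermult:
  assumes "k \<ge> 1" "n \<ge> 1"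
  shows "extremal k * extremal n \<le> extremal (k + n)"
proof -
  consider "k < 10" | "n < 10" | "k \<ge> 10" "n \<ge> 10" by linarith
  then show ?thesis
  proof cases
    case 1
    then show ?thesis using power2_mult_extremal[OF assms(2), of k] by (simp add: extremal_def)
  next
    case 2
    then show ?thesis
      using power2_mult_extremal[OF assms(1), of n] by (simp add: extremal_def mult.commute add.commute)
  next
    case 3
    let ?k = "k div 2" and ?n = "n div 2"
    have "(rook ?k (k - ?k) + 1) * (rook ?n (n - ?n) + 1) \<le>
        rook (?k + ?n) ((k - ?k) + (n - ?n)) + 1"
      by (rule rook_supermult_plus1) (use 3 in auto)
    also have "\<dots> \<le> lambda_num (k + n) + 1"
      using rook_le_lambda_num[of "?k + ?n" "(k - ?k) + (n - ?n)"] by simp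
    finally show ?thesis using 3 by (simp add: extremal_def lambda_num_eq_rook)
  qed
qed

section \<open>Commutative monoids of partial injections\<close>

text \<open>The powers of \<open>x\<close> are eventually periodic. The form \<open>Suc k\<close>
  excludes the trivial exponent 0.\<close>

lemma (in monoid) finite_idempotent_pow:
  assumes "finite (carrier G)" "x \<in> carrier G"
  obtains k :: nat where "x [^] Suc k \<otimes> x [^] Suc k = x [^] Suc k"
proof -
  have "\<not> inj (\<lambda>k::nat. x [^] k)"
    using assms by (metis finite_subset image_subsetI infinite_UNIV_nat finite_imageD nat_pow_closed)
  then obtain i j :: nat where ij: "i < j" "x [^] i = x [^] j"
    by (metis injI linorder_neqE_nat)
  define p where "p = j - i"
  have period: "x [^] (i + s + p) = x [^] (i + s)" for s
    using ij nat_pow_mult[OF assms(2), of i s] nat_pow_mult[OF assms(2), of j s]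
    by (simp add: p_def add.commute add.left_commute)
  have "x [^] (i + s + c * p) = x [^] (i + s)" for s c
  proof (induction c)
    case (Suc c)
    then show ?case using period[of "s + c * p"] by (simp add: algebra_simps)
  qed simp
  \<comment> \<open>\<open>Suc i * p\<close> is a positive multiple of the period that lies beyond
    the preperiod \<open>i\<close>, so doubling this exponent does not change the power.\<close>
  moreover have "i \<le> Suc i * p" using ij(1) mult_le_mono2[of 1 p i]
    unfolding p_def by (metis One_nat_def Suc_leI mult.right_neutral mult_Suc trans_le_add2 zero_less_diff)
  ultimately have "x [^] (Suc i * p + Suc i * p) = x [^] (Suc i * p)"
    by (metis le_add_diff_inverse)
  moreover obtain k where "Suc i * p = Suc k" using ij(1) by (cases "Suc i * p") (auto simp: p_def)
  ultimately show ?thesis using that nat_pow_mult[OF assms(2)] by metis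
qed

section \<open>Splitting a commuting set along an idempotent\<close>

definition commuting :: "('a \<rightharpoonup> 'a) set \<Rightarrow> bool"
  where "commuting S \<longleftrightarrow> (\<forall>f\<in>S. \<forall>g\<in>S. f \<circ>\<^sub>m g = g \<circ>\<^sub>m f)"

lemma commuting_insert:
  "commuting (insert f S) \<longleftrightarrow> (\<forall>g\<in>S. f \<circ>\<^sub>m g = g \<circ>\<^sub>m f) \<and> commuting S"
  unfolding commuting_def by auto

text \<open>Idempotence gives \<open>e y = Some y\<close>, so \<open>x\<close> and \<open>y\<close>
  have the same image and injectivity identifies them: idempotents are partial identities.\<close>

lemma part_inj_idempotentD:
  assumes "e \<in> part_inj X X" "e \<circ>\<^sub>m e = e" "e x = Some y"
  shows "x = y"
proof -
  have "(e \<circ>\<^sub>m e) x = Some y" using assms by simp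
  then have "e y = Some y" using assms(3) by (simp add: map_comp_Some_iff)
  then show ?thesis using part_inj_injD assms by metis
qed

text \<open>Commuting with the partial identity on \<open>D\<close> makes \<open>D\<close> and
  \<open>X - D\<close> invariant under \<open>S\<close>. Restriction to each part then respects
  composition, and an element is recovered from its two restrictions.\<close>

lemma card_le_prod_restrict:
  assumes fin: "finite X" and sub: "S \<subseteq> part_inj X X" and comm: "commuting S"
    and e: "e \<in> S" "e \<circ>\<^sub>m e = e" and D: "D = dom e"
  shows "(\<lambda>f. f |` D) ` S \<subseteq> part_inj D D" "commuting ((\<lambda>f. f |` D) ` S)"
    "(\<lambda>f. f |` (X - D)) ` S \<subseteq> part_inj (X - D) (X - D)" "commuting ((\<lambda>f. f |` (X - D)) ` S)"
    "card S \<le> card ((\<lambda>f. f |` D) ` S) * card ((\<lambda>f. f |` (X - D)) ` S)"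
proof -
  have ex: "e x = (if x \<in> D then Some x else None)" for x
    using part_inj_idempotentD[of e X x] e sub D by (cases "e x") auto
  have stable: "x \<in> D \<longleftrightarrow> y \<in> D" if "f \<in> S" "f x = Some y" for f x y
  proof -
    have "(f \<circ>\<^sub>m e) x = (e \<circ>\<^sub>m f) x" using comm e(1) that by (simp add: commuting_def)
    then show ?thesis using that ex by (auto simp: map_comp_def split: if_splits)
  qed
  have stable': "y \<in> X - D" if "f \<in> S" "f x = Some y" "x \<in> X - D" for f x y
    using that stable part_injD(2)[of f X X x y] sub by auto
  have restr: "commuting ((\<lambda>f. f |` C) ` S)"
    if "\<And>f x y. f \<in> S \<Longrightarrow> f x = Some y \<Longrightarrow> x \<in> C \<Longrightarrow> y \<in> C" for C
  proof -
    have eq: "f |` C \<circ>\<^sub>m g |` C = (f \<circ>\<^sub>m g) |` C" if "g \<in> S" for f g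
    proof
      show "(f |` C \<circ>\<^sub>m g |` C) x = ((f \<circ>\<^sub>m g) |` C) x" for x
        using \<open>\<And>f x y. f \<in> S \<Longrightarrow> f x = Some y \<Longrightarrow> x \<in> C \<Longrightarrow> y \<in> C\<close>[OF that, of x]
        by (auto simp: restrict_map_def map_comp_def split: option.splits)
    qed
    have "f |` C \<circ>\<^sub>m g |` C = g |` C \<circ>\<^sub>m f |` C" if "f \<in> S" "g \<in> S" for f g
    proof -
      have "f \<circ>\<^sub>m g = g \<circ>\<^sub>m f" using comm that by (simp add: commuting_def)
      then show ?thesis using eq[OF that(1), of g] eq[OF that(2), of f] by simp
    qed
    then show ?thesis by (simp add: commuting_def)
  qed
  show "(\<lambda>f. f |` D) ` S \<subseteq> part_inj D D"
    using sub stable by (auto intro: part_inj_restrict)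
  show "(\<lambda>f. f |` (X - D)) ` S \<subseteq> part_inj (X - D) (X - D)"
    using sub stable' by (auto intro!: part_inj_restrict simp del: Diff_iff)
  show "commuting ((\<lambda>f. f |` D) ` S)" "commuting ((\<lambda>f. f |` (X - D)) ` S)"
    using restr[of D] restr[of "X - D"] stable stable' by blast+
  have "finite S" using sub card_part_inj[OF fin fin] finite_subset by auto
  moreover have "inj_on (\<lambda>f. (f |` D, f |` (X - D))) S"
  proof (rule inj_onI)
    fix f g assume fg: "f \<in> S" "g \<in> S" "(f |` D, f |` (X - D)) = (g |` D, g |` (X - D))"
    have "f x = g x" if "x \<in> X" for x
      using fg(3) that by (metis DiffI prod.inject restrict_in)
    then show "f = g" using part_inj_eqI fg sub by blast
  qed
  ultimately show "card S \<le> card ((\<lambda>f. f |` D) ` S) * card ((\<lambda>f. f |` (X - D)) ` S)"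
    unfolding card_cartesian_product[symmetric] by (intro card_inj_on_le) auto
qed

text \<open>The case left when no partial identity with a proper nonempty domain is present. An
  idempotent power of any element is then empty or the identity, so the element is nilpotent or a
  permutation.\<close>

locale irreducible_comm_monoid =
  fixes X :: "'a set" and S :: "('a \<rightharpoonup> 'a) set"
  assumes finite_X: "finite X"
    and sub: "S \<subseteq> part_inj X X"
    and one: "Some |` X \<in> S"
    and closed: "f \<in> S \<Longrightarrow> g \<in> S \<Longrightarrow> f \<circ>\<^sub>m g \<in> S"
    and comm: "commuting S"
    and irreducible: "e \<in> S \<Longrightarrow> e \<circ>\<^sub>m e = e \<Longrightarrow> dom e = {} \<or> dom e = X"
begin

section \<open>Idempotent powers and total elements\<close>

lemma finite_S: "finite S"
  by (rule finite_subset[OF sub]) (simp add: card_part_inj finite_X)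

lemma S_rangeD: "f \<in> S \<Longrightarrow> f x = Some y \<Longrightarrow> x \<in> X \<and> y \<in> X"
  using sub part_injD[of f X X x y] by auto

text \<open>Powers in this structure are composition powers inside \<open>S\<close>.\<close>

abbreviation M where "M \<equiv> (sym_inv_semigroup X)\<lparr>carrier := S\<rparr>"

lemma monoid_M: "monoid M"
proof -
  have "submonoid S (sym_inv_semigroup X)"
    using sub one closed
    by unfold_locales (auto simp: sym_inv_semigroup_def part_inj_def)
  then show ?thesis
    using submonoid.submonoid_is_monoid monoid_sym_inv_semigroup by blast
qed

lemma mult_M: "f \<otimes>\<^bsub>M\<^esub> g = f \<circ>\<^sub>m g"
  by (simp add: sym_inv_semigroup_def)

text \<open>An idempotent positive power of \<open>f\<close> is presented as \<open>f\<close> times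
  another power, so that its domain can be traced back to \<open>f\<close>. The last clause is
  induction over powers, which spares later proofs the power notation.\<close>

lemma idempotent_pow:
  assumes "f \<in> S"
  obtains g where "g \<in> S" "f \<circ>\<^sub>m g \<in> S" "(f \<circ>\<^sub>m g) \<circ>\<^sub>m (f \<circ>\<^sub>m g) = f \<circ>\<^sub>m g"
    "\<And>P. P (Some |` X) \<Longrightarrow> (\<And>h. P h \<Longrightarrow> P (f \<circ>\<^sub>m h)) \<Longrightarrow> P (f \<circ>\<^sub>m g)"
proof -
  interpret M: monoid M by (rule monoid_M)
  obtain k :: nat where k: "f [^]\<^bsub>M\<^esub> Suc k \<otimes>\<^bsub>M\<^esub> f [^]\<^bsub>M\<^esub> Suc k = f [^]\<^bsub>M\<^esub> Suc k"
    using M.finite_idempotent_pow[of f] finite_S assms by auto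
  have Suc: "f [^]\<^bsub>M\<^esub> Suc j = f \<circ>\<^sub>m f [^]\<^bsub>M\<^esub> j" for j :: nat
    unfolding mult_M[symmetric] by (rule M.nat_pow_Suc2) (use assms in simp)
  have in_S: "f [^]\<^bsub>M\<^esub> j \<in> S" for j :: nat
    using M.nat_pow_closed[of f j] assms by simp
  show ?thesis
  proof (rule that[of "f [^]\<^bsub>M\<^esub> k"])
    fix P :: "('a \<rightharpoonup> 'a) \<Rightarrow> bool"
    assume P: "P (Some |` X)" "\<And>h. P h \<Longrightarrow> P (f \<circ>\<^sub>m h)"
    have "P (f [^]\<^bsub>M\<^esub> j)" for j :: nat
    proof (induction j)
      case 0
      then show ?case using P(1) by (simp add: sym_inv_semigroup_def nat_pow_def)
    next
      case (Suc j)
      then show ?case unfolding \<open>\<And>j. f [^]\<^bsub>M\<^esub> Suc j = f \<circ>\<^sub>m f [^]\<^bsub>M\<^esub> j\<close> by (rule P(2))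
    qed
    then show "P (f \<circ>\<^sub>m f [^]\<^bsub>M\<^esub> k)" using P(2) by blast
  qed (use in_S k[unfolded mult_M Suc] in_S[of "Suc k", unfolded Suc] in auto)
qed

text \<open>Every power of \<open>f\<close> fixes \<open>p\<close>, so the idempotent power is not
  empty and must be total. Written with \<open>f\<close> applied first, it forces \<open>f\<close>
  to be total.\<close>

lemma fixpoint_total:
  assumes "f \<in> S" "f p = Some p"
  shows "dom f = X"
proof -
  obtain g where g: "g \<in> S" "f \<circ>\<^sub>m g \<in> S" "(f \<circ>\<^sub>m g) \<circ>\<^sub>m (f \<circ>\<^sub>m g) = f \<circ>\<^sub>m g"
    "\<And>P. P (Some |` X) \<Longrightarrow> (\<And>h. P h \<Longrightarrow> P (f \<circ>\<^sub>m h)) \<Longrightarrow> P (f \<circ>\<^sub>m g)"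
    using idempotent_pow assms(1) by blast
  have "(f \<circ>\<^sub>m g) p = Some p"
    using g(4)[of "\<lambda>h. h p = Some p"] assms S_rangeD by (auto simp: map_comp_Some_iff)
  then have "dom (f \<circ>\<^sub>m g) = X" using irreducible[OF g(2,3)] by blast
  moreover have "f \<circ>\<^sub>m g = g \<circ>\<^sub>m f" using comm assms(1) g(1) by (simp add: commuting_def)
  ultimately have "X \<subseteq> dom f" by (auto simp: dom_def map_comp_Some_iff)
  then show ?thesis using S_rangeD[OF assms(1)] by auto
qed

text \<open>Powers of a total \<open>f\<close> are total, and a total idempotent is the identity.
  Hence the cofactor \<open>g\<close> in the idempotent power is inverse to
  \<open>f\<close>.\<close>

lemma total_invertible:
  assumes "f \<in> S" "dom f = X" "f x = Some y"
  shows "\<exists>g\<in>S. g y = Some x"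
proof -
  obtain g where g: "g \<in> S" "f \<circ>\<^sub>m g \<in> S" "(f \<circ>\<^sub>m g) \<circ>\<^sub>m (f \<circ>\<^sub>m g) = f \<circ>\<^sub>m g"
    "\<And>P. P (Some |` X) \<Longrightarrow> (\<And>h. P h \<Longrightarrow> P (f \<circ>\<^sub>m h)) \<Longrightarrow> P (f \<circ>\<^sub>m g)"
    using idempotent_pow assms(1) by blast
  have tot: "\<exists>z\<in>X. f u = Some z" if "u \<in> X" for u
    using that assms(1,2) S_rangeD by blast
  have "\<forall>u\<in>X. \<exists>z\<in>X. (f \<circ>\<^sub>m g) u = Some z"
    by (rule g(4)) (auto simp: map_comp_Some_iff dest: tot, metis tot)
  moreover have "x \<in> X" using S_rangeD assms by blast
  ultimately have "(f \<circ>\<^sub>m g) x = Some x"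
    using part_inj_idempotentD[OF _ g(3)] g(2) sub by blast
  moreover have "f \<circ>\<^sub>m g = g \<circ>\<^sub>m f" using comm assms(1) g(1) by (simp add: commuting_def)
  ultimately show ?thesis using g(1) assms(3) by (auto simp: map_comp_Some_iff)
qed

section \<open>The reachability preorder and its minimal classes\<close>

definition reach :: "'a \<Rightarrow> 'a \<Rightarrow> bool"
  where "reach x y \<longleftrightarrow> (\<exists>f\<in>S. f x = Some y)"

lemma reach_refl: "x \<in> X \<Longrightarrow> reach x x"
  unfolding reach_def using one by (intro bexI[of _ "Some |` X"]) auto

lemma reach_trans: "reach x y \<Longrightarrow> reach y z \<Longrightarrow> reach x z"
  unfolding reach_def
proof (elim bexE)
  fix f g assume "f \<in> S" "f x = Some y" "g \<in> S" "g y = Some z"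
  then show "\<exists>h\<in>S. h x = Some z" using closed[of g f] by (intro bexI[of _ "g \<circ>\<^sub>m f"]) simp_all
qed

lemma reach_in_X: "reach x y \<Longrightarrow> x \<in> X \<and> y \<in> X"
  unfolding reach_def using S_rangeD by auto

text \<open>Following \<open>f\<close> by a map back to \<open>x\<close> gives an element with a
  fixed point, which is total.\<close>

lemma return_total:
  assumes "f \<in> S" "f x = Some y" "reach y x"
  shows "dom f = X"
proof -
  obtain g where g: "g \<in> S" "g y = Some x" using assms(3) by (auto simp: reach_def)
  have "(g \<circ>\<^sub>m f) x = Some x" using g assms by (simp add: map_comp_Some_iff)
  then have "dom (g \<circ>\<^sub>m f) = X" using fixpoint_total closed g assms by blast
  then have "X \<subseteq> dom f" by (auto simp: dom_def map_comp_Some_iff)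
  then show ?thesis using S_rangeD[OF assms(1)] by auto
qed

definition cls :: "'a \<Rightarrow> 'a set"
  where "cls x = {y. reach x y \<and> reach y x}"

definition minimal :: "'a \<Rightarrow> bool"
  where "minimal x \<longleftrightarrow> x \<in> X \<and> (\<forall>y. reach y x \<longrightarrow> reach x y)"

text \<open>Among the points reaching \<open>x\<close>, take one with the fewest points below it;
  anything below it has the same down-set and is therefore equivalent to it.\<close>

lemma ex_minimal_below:
  assumes "x \<in> X"
  shows "\<exists>p. minimal p \<and> reach p x"
proof -
  let ?below = "\<lambda>p. {z. reach z p}"
  have fin: "finite (?below p)" for p
    by (rule finite_subset[OF _ finite_X]) (auto dest: reach_in_X)
  obtain p where p: "reach p x" "\<And>q. reach q x \<Longrightarrow> card (?below p) \<le> card (?below q)"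
    using ex_has_least_nat[of "\<lambda>p. reach p x" x "\<lambda>p. card (?below p)"] reach_refl[OF assms] by blast
  have "reach p y" if "reach y p" for y
  proof -
    have "?below y \<subseteq> ?below p" using that reach_trans by blast
    moreover have "card (?below p) \<le> card (?below y)" using p that reach_trans by blast
    ultimately have "?below y = ?below p" using fin card_seteq by blast
    then show ?thesis using reach_refl[of p] reach_in_X[OF p(1)] by blast
  qed
  then show ?thesis using p(1) reach_in_X by (auto simp: minimal_def)
qed

text \<open>Since \<open>rep\<close> depends only on the class, equivalent points share a
  representative. Reachability of a minimal point can be reversed, so distinct representatives are
  incomparable.\<close>

lemma ex_transversal:
  obtains A where "A \<subseteq> X" "\<And>p. p \<in> A \<Longrightarrow> minimal p"
    "\<And>p q. p \<in> A \<Longrightarrow> q \<in> A \<Longrightarrow> reach p q \<Longrightarrow> p = q" "\<And>x. x \<in> X \<Longrightarrow> \<exists>p\<in>A. reach p x"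
proof -
  define rep where "rep x = (SOME y. y \<in> cls x)" for x
  have rep: "rep x \<in> cls x" if "x \<in> X" for x
  proof -
    have "x \<in> cls x" using reach_refl[OF that] by (simp add: cls_def)
    then show ?thesis unfolding rep_def by (rule someI)
  qed
  have min: "minimal (rep x)" if "minimal x" for x
    using that rep[of x] reach_trans reach_in_X unfolding minimal_def cls_def by blast
  have eq: "rep x = rep y" if "reach x y" "reach y x" for x y
  proof -
    have "cls x = cls y" using that reach_trans unfolding cls_def by blast
    then show ?thesis by (simp add: rep_def)
  qed
  have rep_rep: "rep (rep x) = rep x" if "x \<in> X" for x
    using eq[of x "rep x"] rep[OF that] by (simp add: cls_def)
  show ?thesis
  proof (rule that[of "rep ` {x. minimal x}"])
    show "rep ` {x. minimal x} \<subseteq> X" using min by (auto simp: minimal_def)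
    show "minimal p" if "p \<in> rep ` {x. minimal x}" for p
      using that min by auto
    show "p = q" if pq: "p \<in> rep ` {x. minimal x}" "q \<in> rep ` {x. minimal x}" "reach p q" for p q
    proof -
      obtain x y where xy: "p = rep x" "q = rep y" "minimal x" "minimal y" using pq by blast
      have "reach q p" using pq(3) min[OF xy(4)] xy(2) by (simp add: minimal_def)
      then show ?thesis using eq[OF pq(3)] xy rep_rep by (simp add: minimal_def)
    qed
    show "\<exists>p\<in>rep ` {x. minimal x}. reach p x" if x: "x \<in> X" for x
    proof -
      obtain p where p: "minimal p" "reach p x" using ex_minimal_below[OF x] by blast
      then have "reach (rep p) x"
        using rep[of p] reach_trans by (auto simp: minimal_def cls_def)
      then show ?thesis using p by blast
    qed
  qed
qed

text \<open>
  If \<open>x = h p\<close> with \<open>h \<in> S\<close>, then \<open>f x = f (h p) = h (f p)\<close>: values on a set reaching every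
  point determine \<open>f\<close>.
\<close>

lemma eq_if_eq_on_transversal:
  assumes A: "\<And>x. x \<in> X \<Longrightarrow> \<exists>p\<in>A. reach p x"
    and fg: "f \<in> S" "g \<in> S" "\<And>p. p \<in> A \<Longrightarrow> f p = g p"
  shows "f = g"
proof (rule part_inj_eqI)
  show "f \<in> part_inj X X" "g \<in> part_inj X X" using fg sub by auto
  show "f x = g x" if x: "x \<in> X" for x
  proof -
    obtain p h where h: "p \<in> A" "h \<in> S" "h p = Some x"
      using A[OF x] by (auto simp: reach_def)
    have "f x = (f \<circ>\<^sub>m h) p" using h by simp
    also have "\<dots> = (h \<circ>\<^sub>m f) p" using comm fg h by (simp add: commuting_def)
    also have "\<dots> = (h \<circ>\<^sub>m g) p" using fg(3)[OF h(1)] by (simp add: map_comp_def)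
    also have "\<dots> = (g \<circ>\<^sub>m h) p" using comm fg h by (simp add: commuting_def)
    also have "\<dots> = g x" using h by simp
    finally show ?thesis .
  qed
qed

text \<open>With \<open>card X = d + (card A + card Y)\<close>, permutations contribute at most
  \<open>2 ^ d\<close> elements and the others at most \<open>rook (card A) (card Y)\<close>. The
  sum is at most \<open>2 ^ d * (lambda_num (card A + card Y) + 1)\<close>, and the power of two is
  absorbed by adding \<open>d\<close> points.\<close>

lemma card_le_extremal:
  assumes "X \<noteq> {}"
  shows "card S \<le> extremal (card X)"
proof -
  obtain A where A: "A \<subseteq> X" "\<And>p. p \<in> A \<Longrightarrow> minimal p"
    "\<And>p q. p \<in> A \<Longrightarrow> q \<in> A \<Longrightarrow> reach p q \<Longrightarrow> p = q" "\<And>x. x \<in> X \<Longrightarrow> \<exists>p\<in>A. reach p x"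
    using ex_transversal by blast
  define Y where "Y = X - (\<Union>p\<in>A. cls p)"
  \<comment> \<open>\<open>d\<close> counts the points of minimal classes other than the chosen
    representatives.\<close>
  define d where "d = (\<Sum>p\<in>A. card (cls p) - 1)"
  have "cls p \<subseteq> X" for p using reach_in_X by (auto simp: cls_def)
  then have fin: "finite A" "finite Y" "finite (cls p)" for p
    using finite_X A(1) finite_subset[of _ X] by (auto simp: Y_def)
  have mem_cls: "p \<in> cls p" if "p \<in> A" for p
    using that A(1) reach_refl by (auto simp: cls_def)
  have cls_pos: "card (cls p) \<ge> 1" if "p \<in> A" for p
    using mem_cls[OF that] fin(3)[of p] by (simp add: Suc_le_eq card_gt_0_iff) blast
  \<comment> \<open>If \<open>z\<close> were in the class of another representative
    \<open>q\<close>, then \<open>p\<close> would reach \<open>q\<close> through \<open>z\<close>,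
    against incomparability.\<close>
  have target: "z \<in> cls p \<or> z \<in> Y" if "p \<in> A" "reach p z" for p z
  proof (rule ccontr)
    assume "\<not> (z \<in> cls p \<or> z \<in> Y)"
    then obtain q where q: "q \<in> A" "z \<in> cls q" "z \<notin> cls p"
      using reach_in_X[OF \<open>reach p z\<close>] by (auto simp: Y_def)
    then have "p = q"
      using A(3)[OF \<open>p \<in> A\<close> q(1)] reach_trans[OF \<open>reach p z\<close>] by (auto simp: cls_def)
    then show False using q by simp
  qed
  have "cls p \<inter> cls q = {}" if "p \<in> A" "q \<in> A" "p \<noteq> q" for p q
    using A(3)[OF that(1,2)] that(3) reach_trans unfolding cls_def by blast
  then have "card (\<Union>p\<in>A. cls p) = (\<Sum>p\<in>A. card (cls p))"
    using fin by (intro card_UN_disjoint) auto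
  moreover have "(\<Union>p\<in>A. cls p) \<subseteq> X" using reach_in_X by (auto simp: cls_def)
  ultimately have "card X = (\<Sum>p\<in>A. card (cls p)) + card Y"
    unfolding Y_def using finite_X
    by (metis card_Diff_subset card_mono finite_subset le_add_diff_inverse)
  moreover have "(\<Sum>p\<in>A. card (cls p)) = (\<Sum>p\<in>A. card (cls p) - 1 + 1)"
    by (intro sum.cong refl le_add_diff_inverse2[symmetric] cls_pos)
  then have "(\<Sum>p\<in>A. card (cls p)) = d + card A"
    by (simp add: d_def sum.distrib del: One_nat_def)
  ultimately have card_X: "card X = d + (card A + card Y)" by simp
  have "A \<noteq> {}" using A(4) assms by blast
  then have a_pos: "card A \<ge> 1" using fin(1) by (simp add: Suc_le_eq card_gt_0_iff)

  \<comment> \<open>\<open>S1\<close> collects the permutations and \<open>S2\<close> the nilpotent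
    elements. If a single representative stays in its class, then \<open>f\<close> is total, hence
    invertible in \<open>S\<close>, so all representatives stay in theirs; otherwise
    \<open>target\<close> sends every value on \<open>A\<close> into \<open>Y\<close>.\<close>
  define S1 where "S1 = {f \<in> S. \<forall>p\<in>A. \<exists>z\<in>cls p. f p = Some z}"
  define S2 where "S2 = {f \<in> S. \<forall>p\<in>A. \<forall>z. f p = Some z \<longrightarrow> z \<in> Y}"
  have "S \<subseteq> S1 \<union> S2"
  proof
    fix f assume f: "f \<in> S"
    show "f \<in> S1 \<union> S2"
    proof (cases "\<exists>p\<in>A. \<exists>z\<in>cls p. f p = Some z")
      case True
      then have tot: "dom f = X" using return_total f by (auto simp: cls_def)
      have "\<exists>z\<in>cls p. f p = Some z" if "p \<in> A" for p
      proof -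
        obtain z where z: "f p = Some z" using tot A(1) \<open>p \<in> A\<close> by (metis domD subsetD)
        then have "z \<in> cls p"
          using total_invertible[OF f tot z] f by (auto simp: cls_def reach_def)
        then show ?thesis using z by blast
      qed
      then show ?thesis using f by (simp add: S1_def)
    next
      case False
      have "z \<in> Y" if "p \<in> A" "f p = Some z" for p z
        using target[of p z] that f False by (auto simp: reach_def)
      then show ?thesis using f by (simp add: S2_def)
    qed
  qed
  then have "card S \<le> card (S1 \<union> S2)"
    by (rule card_mono[rotated]) (use finite_S in \<open>simp add: S1_def S2_def\<close>)
  also have "\<dots> \<le> card S1 + card S2" by (rule card_Un_le)
  also have "card S1 \<le> 2 ^ d"
  proof -
    \<comment> \<open>Elements of \<open>S1\<close> are defined on all of \<open>A\<close>, so
      \<open>the\<close> loses nothing; \<open>restrict\<close> places the result in a dependent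
      product, whose size is known.\<close>
    let ?r = "\<lambda>f. restrict (\<lambda>p. the (f p)) A"
    have "inj_on ?r S1"
    proof (rule inj_onI)
      fix f g assume fg: "f \<in> S1" "g \<in> S1" "?r f = ?r g"
      have "f p = g p" if "p \<in> A" for p
      proof -
        have "the (f p) = the (g p)" using fun_cong[OF fg(3), of p] that by simp
        moreover obtain y z where "f p = Some y" "g p = Some z"
          using fg(1,2) \<open>p \<in> A\<close> unfolding S1_def by blast
        ultimately show ?thesis by simp
      qed
      then show "f = g" using eq_if_eq_on_transversal[OF A(4)] fg by (auto simp: S1_def)
    qed
    moreover have "?r ` S1 \<subseteq> PiE A cls" by (auto simp: S1_def)
    moreover have "finite (PiE A cls)" using fin by (intro finite_PiE) auto
    ultimately have "card S1 \<le> card (PiE A cls)" by (rule card_inj_on_le)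
    also have "\<dots> = (\<Prod>p\<in>A. card (cls p))" using fin(1) by (rule card_PiE)
    \<comment> \<open>A class with \<open>k\<close> points besides its representative contributes
      the factor \<open>k + 1 \<le> 2 ^ k\<close>.\<close>
    also have "\<dots> \<le> (\<Prod>p\<in>A. 2 ^ (card (cls p) - 1))"
    proof (rule prod_mono)
      fix p assume "p \<in> A"
      then obtain k where "card (cls p) = Suc k" using cls_pos by (metis Suc_le_D One_nat_def)
      then show "0 \<le> card (cls p) \<and> card (cls p) \<le> 2 ^ (card (cls p) - 1)"
        using Suc_leI[OF less_exp[of k]] by simp
    qed
    also have "\<dots> = 2 ^ d" by (simp add: d_def power_sum)
    finally show ?thesis .
  qed
  also have "card S2 \<le> rook (card A) (card Y)"
  proof -
    have "inj_on (\<lambda>f. f |` A) S2"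
    proof (rule inj_onI)
      fix f g assume fg: "f \<in> S2" "g \<in> S2" "f |` A = g |` A"
      have "f p = g p" if "p \<in> A" for p
        using fun_cong[OF fg(3), of p] that by auto
      then show "f = g" using eq_if_eq_on_transversal[OF A(4)] fg by (auto simp: S2_def)
    qed
    moreover have "(\<lambda>f. f |` A) ` S2 \<subseteq> part_inj A Y"
      using sub by (auto simp: S2_def intro!: part_inj_restrict)
    ultimately have "card S2 \<le> card (part_inj A Y)"
      using card_part_inj[OF fin(1,2)] by (intro card_inj_on_le) auto
    then show ?thesis using card_part_inj[OF fin(1,2)] by simp
  qed
  also have "2 ^ d + rook (card A) (card Y) \<le> 2 ^ d * (lambda_num (card A + card Y) + 1)"
  proof -
    have "rook (card A) (card Y) \<le> 2 ^ d * lambda_num (card A + card Y)"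
      using rook_le_lambda_num[of "card A" "card Y"] mult_le_mono[of 1 "2 ^ d"] by fastforce
    then show ?thesis by simp
  qed
  also have "\<dots> \<le> 2 ^ d * extremal (card A + card Y)"
    using a_pos by (intro mult_le_mono2 lambda_num_le_extremal) simp
  also have "\<dots> \<le> extremal (card X)"
    unfolding card_X using a_pos by (intro power2_mult_extremal) simp
  finally show ?thesis by simp
qed

end

text \<open>Strong induction on \<open>card X\<close>, after enlarging \<open>S\<close> to a maximal
  commuting set. A proper idempotent splits \<open>X\<close> into two smaller nonempty parts, whose
  bounds multiply; without one, the maximal set is an irreducible monoid.\<close>

lemma card_commuting_le_extremal:
  assumes "finite X" "X \<noteq> {}" "S \<subseteq> part_inj X X" "commuting S"
  shows "card S \<le> extremal (card X)"
  using assms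
proof (induction "card X" arbitrary: X S rule: less_induct)
  case less
  let ?C = "{T. T \<subseteq> part_inj X X \<and> commuting T}"
  have fin: "finite (part_inj X X)" using card_part_inj[OF less.prems(1,1)] by simp
  have finC: "finite ?C" by (rule finite_subset[of _ "Pow (part_inj X X)"]) (use fin in auto)
  have "S \<in> ?C" using less.prems by simp
  \<comment> \<open>a maximal commuting set is its own commutant, hence a submonoid\<close>
  from finite_has_maximal2[OF finC this]
  obtain T where T: "T \<in> ?C" "S \<subseteq> T" and max: "\<forall>U\<in>?C. T \<subseteq> U \<longrightarrow> T = U"
    by (elim bexE conjE)
  have mem: "h \<in> T" if "h \<in> part_inj X X" "\<And>f. f \<in> T \<Longrightarrow> h \<circ>\<^sub>m f = f \<circ>\<^sub>m h" for h
  proof -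
    have "insert h T \<in> ?C" using T that by (simp add: commuting_insert)
    then show ?thesis using max by blast
  qed
  have finT: "finite T" using T finite_subset[OF _ fin] by simp
  have "card S \<le> card T" using T finT by (simp add: card_mono)
  also have "card T \<le> extremal (card X)"
  proof (cases "\<exists>e\<in>T. e \<circ>\<^sub>m e = e \<and> dom e \<noteq> {} \<and> dom e \<noteq> X")
    case True
    then obtain e where e: "e \<in> T" "e \<circ>\<^sub>m e = e" "dom e \<noteq> {}" "dom e \<noteq> X" by blast
    define D where "D = dom e"
    have "D \<subseteq> X" using e(1) T by (fastforce simp: D_def part_inj_def)
    then have ne: "D \<noteq> {}" "X - D \<noteq> {}" and fin: "finite D" "finite (X - D)"
      using e(3,4) less.prems(1) finite_subset[of D X] by (auto simp: D_def)
    then have pos: "card D \<ge> 1" "card (X - D) \<ge> 1" by (simp_all add: Suc_le_eq card_gt_0_iff)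
    have card_X: "card X = card D + card (X - D)"
      using \<open>D \<subseteq> X\<close> fin(1) less.prems(1) by (simp add: card_Diff_subset card_mono)
    then have lt: "card D < card X" "card (X - D) < card X" using pos by auto
    note split = card_le_prod_restrict[OF less.prems(1) _ _ e(1,2) D_def]
    have "card ((\<lambda>f. f |` D) ` T) \<le> extremal (card D)"
      using less.hyps[OF lt(1) fin(1) ne(1)] split T by blast
    moreover have "card ((\<lambda>f. f |` (X - D)) ` T) \<le> extremal (card (X - D))"
      using less.hyps[OF lt(2) fin(2) ne(2)] split T by blast
    ultimately have "card T \<le> extremal (card D) * extremal (card (X - D))"
      using split(5) T mult_le_mono by (metis (no_types, lifting) le_trans mem_Collect_eq)
    also have "\<dots> \<le> extremal (card X)"
      unfolding card_X by (rule extremal_supermult) (rule pos)+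
    finally show ?thesis .
  next
    case False
    interpret irreducible_comm_monoid X T
    proof
      show "Some |` X \<in> T"
      proof (rule mem)
        fix f assume "f \<in> T"
        then show "Some |` X \<circ>\<^sub>m f = f \<circ>\<^sub>m Some |` X" using T part_inj_id_comm by blast
      qed (rule part_inj_idem, simp)
      show "f \<circ>\<^sub>m g \<in> T" if "f \<in> T" "g \<in> T" for f g
      proof (rule mem)
        show "f \<circ>\<^sub>m g \<in> part_inj X X" using that T part_inj_comp by blast
        have assoc: "(u \<circ>\<^sub>m v) \<circ>\<^sub>m w = u \<circ>\<^sub>m (v \<circ>\<^sub>m w)" for u v w :: "'a \<rightharpoonup> 'a"
          by (auto simp: map_comp_def split: option.splits)
        show "f \<circ>\<^sub>m g \<circ>\<^sub>m h = h \<circ>\<^sub>m (f \<circ>\<^sub>m g)" if "h \<in> T" for h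
          using that \<open>f \<in> T\<close> \<open>g \<in> T\<close> T by (simp add: commuting_def) (metis assoc)
      qed
    qed (use T False less.prems(1) in auto)
    show ?thesis by (rule card_le_extremal) (rule less.prems(2))
  qed
  finally show ?case .
qed

section \<open>The clique number\<close>

lemma carrier_sym_inv_semigroup: "carrier (sym_inv_semigroup X) = part_inj X X"
  by (simp add: sym_inv_semigroup_def part_inj_def)

lemma mult_sym_inv_semigroup: "f \<otimes>\<^bsub>sym_inv_semigroup X\<^esub> g = f \<circ>\<^sub>m g"
  by (simp add: sym_inv_semigroup_def)

lemma restrict_Some_comp: "Some |` D \<circ>\<^sub>m Some |` E = Some |` (D \<inter> E)"
  by (auto simp: map_comp_def restrict_map_def)

text \<open>Commuting with the partial identities on single points makes a central \<open>f\<close>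
  a partial identity. If its domain contained \<open>x\<close> but not some \<open>y\<close> in
  \<open>X\<close>, it would not commute with the one-point map
  \<open>[x \<mapsto> y]\<close>.\<close>

lemma center_sym_inv_semigroup:
  "semigroup_center (sym_inv_semigroup X) = {Map.empty, Some |` X}"
proof (intro subset_antisym subsetI)
  fix f assume "f \<in> semigroup_center (sym_inv_semigroup X)"
  then have f: "f \<in> part_inj X X" and comm: "\<And>g. g \<in> part_inj X X \<Longrightarrow> f \<circ>\<^sub>m g = g \<circ>\<^sub>m f"
    unfolding semigroup_center_def carrier_sym_inv_semigroup mult_sym_inv_semigroup by blast+
  have fixes_x: "f x = Some x" if "f x = Some y" for x y
  proof -
    have "x \<in> X" by (rule part_injD(1)[OF f that])
    then have "f \<circ>\<^sub>m Some |` {x} = Some |` {x} \<circ>\<^sub>m f" by (intro comm part_inj_idem) simp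
    then have "(f \<circ>\<^sub>m Some |` {x}) x = (Some |` {x} \<circ>\<^sub>m f) x" by simp
    then show ?thesis using that by (simp add: restrict_map_def split: if_splits)
  qed
  show "f \<in> {Map.empty, Some |` X}"
  proof (rule ccontr)
    assume neq: "f \<notin> {Map.empty, Some |` X}"
    then have "f \<noteq> Map.empty" by simp
    then obtain x where x: "f x = Some x" using fixes_x by (metis ext not_None_eq)
    have "\<exists>y\<in>X. f y \<noteq> Some y"
    proof (rule ccontr)
      assume *: "\<not> (\<exists>y\<in>X. f y \<noteq> Some y)"
      have "f = Some |` X"
        by (rule part_inj_eqI[OF f part_inj_idem]) (use * in auto)
      then show False using neq by simp
    qed
    then obtain y where y: "y \<in> X" "f y = None" using fixes_x by (metis not_None_eq)
    have "x \<in> X" by (rule part_injD(1)[OF f x])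
    then have "[x \<mapsto> y] \<in> part_inj X X" using y by (intro part_injI) (auto split: if_splits)
    then have "(f \<circ>\<^sub>m [x \<mapsto> y]) x = ([x \<mapsto> y] \<circ>\<^sub>m f) x" using comm by simp
    then show False using x y by simp
  qed
next
  fix f assume "f \<in> {Map.empty, Some |` X}"
  moreover have "Map.empty \<in> part_inj X X" by (simp add: part_inj_def)
  moreover have "Map.empty \<circ>\<^sub>m g = g \<circ>\<^sub>m Map.empty" for g :: "'a \<rightharpoonup> 'a"
    by (auto simp: map_comp_def split: option.splits)
  ultimately show "f \<in> semigroup_center (sym_inv_semigroup X)"
    using part_inj_idem[of X X] part_inj_id_comm[of _ X]
    by (auto simp: semigroup_center_def carrier_sym_inv_semigroup mult_sym_inv_semigroup)
qed

text \<open>Cliques only compare distinct elements, but every element commutes with itself, so the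
  two conditions agree.\<close>

lemma clique_commuting_graph:
  "K \<subseteq> fst (commuting_graph (sym_inv_semigroup X)) \<and>
      clique K (snd (commuting_graph (sym_inv_semigroup X))) \<longleftrightarrow>
    K \<subseteq> part_inj X X - {Map.empty, Some |` X} \<and> commuting K"
  by (auto simp: commuting_graph_def Let_def center_sym_inv_semigroup carrier_sym_inv_semigroup
      mult_sym_inv_semigroup clique_def commuting_def doubleton_eq_iff subset_iff) metis+

text \<open>Adjoining the two central elements keeps the set commuting. They are distinct because
  \<open>X\<close> is nonempty, which gives the subtraction of 2.\<close>

lemma card_clique_le:
  assumes "finite X" "X \<noteq> {}" "K \<subseteq> part_inj X X - {Map.empty, Some |` X}" "commuting K"
  shows "card K \<le> extremal (card X) - 2"
proof -
  let ?K = "insert Map.empty (insert (Some |` X) K)"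
  have sub: "?K \<subseteq> part_inj X X" using assms(3) part_inj_idem[of X X] by (auto simp: part_inj_def)
  have "Map.empty \<circ>\<^sub>m g = g \<circ>\<^sub>m Map.empty" for g :: "'a \<rightharpoonup> 'a"
    by (auto simp: map_comp_def split: option.splits)
  then have "commuting ?K"
    using assms(4) part_inj_id_comm[of _ X] sub by (auto simp: commuting_insert)
  then have "card ?K \<le> extremal (card X)"
    using card_commuting_le_extremal assms(1,2) sub by blast
  moreover have "Map.empty \<noteq> Some |` X"
    using assms(2) by (metis ex_in_conv option.distinct(1) restrict_in)
  moreover have "finite K" using sub finite_subset card_part_inj[OF assms(1,1)] by auto
  moreover have "Map.empty \<notin> K" "Some |` X \<notin> K" using assms(3) by auto
  ultimately show ?thesis by simp
qed

text \<open>Partial identities commute, their product being the one on the intersection; the subsets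
  \<open>{}\<close> and \<open>X\<close> give the center and are left out.\<close>

lemma ex_idempotent_clique:
  assumes "finite X" "X \<noteq> {}"
  shows "\<exists>K \<subseteq> part_inj X X - {Map.empty, Some |` X}. commuting K \<and> card K = 2 ^ card X - 2"
proof (intro exI[of _ "(\<lambda>D. Some |` D) ` (Pow X - {{}, X})"] conjI)
  have inj: "D = E" if "Some |` D = Some |` E" for D E :: "'a set"
  proof (rule Set.set_eqI)
    show "x \<in> D \<longleftrightarrow> x \<in> E" for x
      using fun_cong[OF that, of x] by (simp add: restrict_map_def split: if_splits)
  qed
  show "(\<lambda>D. Some |` D) ` (Pow X - {{}, X}) \<subseteq> part_inj X X - {Map.empty, Some |` X}"
    using inj[of _ X] inj[of _ "{}"] by (auto intro: part_inj_idem)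
  show "commuting ((\<lambda>D. Some |` D) ` (Pow X - {{}, X}))"
    by (auto simp: commuting_def restrict_Some_comp Int_commute)
  have "card ((\<lambda>D. Some |` D) ` (Pow X - {{}, X})) = card (Pow X - {{}, X})"
    by (intro card_image inj_onI inj)
  also have "\<dots> = 2 ^ card X - 2"
    using assms by (subst card_Diff_subset) (auto simp: card_Pow)
  finally show "card ((\<lambda>D. Some |` D) ` (Pow X - {{}, X})) = 2 ^ card X - 2" .
qed

text \<open>All products of maps from \<open>A\<close> to its complement are empty, so these maps
  commute. The identity is not among them, so only the empty map is removed, which gives the
  subtraction of 1.\<close>

lemma ex_null_clique:
  assumes "finite X" "card X = n" "n \<ge> 2"
  shows "\<exists>K \<subseteq> part_inj X X - {Map.empty, Some |` X}. commuting K \<and> card K = lambda_num n - 1"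
proof -
  obtain A where A: "A \<subseteq> X" "card A = n div 2" "finite A"
    using obtain_subset_with_card_n[of "n div 2" X] assms(2) by auto
  let ?B = "X - A"
  have B: "card ?B = n - n div 2" using A assms by (simp add: card_Diff_subset)
  have "card ?B > 0" using B assms by simp
  then have "?B \<noteq> {}" by (metis card.empty less_irrefl)
  let ?N = "part_inj A ?B"
  have N: "finite ?N" "card ?N = lambda_num n"
    using card_part_inj[of A ?B] A B assms(1) by (simp_all add: lambda_num_eq_rook)
  have null: "f \<circ>\<^sub>m g = Map.empty" if "f \<in> ?N" "g \<in> ?N" for f g
  proof
    fix x show "(f \<circ>\<^sub>m g) x = None"
    proof (cases "g x")
      case (Some y)
      then have "y \<notin> A" using part_injD[OF that(2)] by blast
      then have "f y = None" using part_injD[OF that(1)] by (cases "f y") blast+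
      then show ?thesis using Some by simp
    qed simp
  qed
  have "?N \<subseteq> part_inj X X" using A(1) by (auto simp: part_inj_def)
  moreover have "Some |` X \<notin> ?N"
  proof
    assume *: "Some |` X \<in> ?N"
    obtain x where "x \<in> ?B" using \<open>?B \<noteq> {}\<close> by blast
    then show False using part_injD(1)[OF *, of x x] by simp
  qed
  moreover have "commuting (?N - {Map.empty})" using null by (simp add: commuting_def)
  moreover have "Map.empty \<in> ?N" by (simp add: part_inj_def)
  ultimately show ?thesis
    using N by (intro exI[of _ "?N - {Map.empty}"]) auto
qed

text \<open>The two cases of the theorem differ only in the clique attaining the bound:
  \<open>extremal n - 2\<close> is \<open>2 ^ n - 2\<close> below 10 and
  \<open>lambda_num n - 1\<close> from 10 on.\<close>

lemma clique_number_eq: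
  assumes "finite X" "X \<noteq> {}"
    and "\<exists>K \<subseteq> part_inj X X - {Map.empty, Some |` X}. commuting K \<and> card K = extremal (card X) - 2"
  shows "clique_number (commuting_graph (sym_inv_semigroup X)) = extremal (card X) - 2"
  unfolding clique_number_def clique_commuting_graph
proof (rule Max_eqI)
  have sub: "{K. K \<subseteq> part_inj X X - {Map.empty, Some |` X} \<and> commuting K} \<subseteq> Pow (part_inj X X)" by auto
  show "finite (card ` {K. K \<subseteq> part_inj X X - {Map.empty, Some |` X} \<and> commuting K})"
    using card_part_inj[OF assms(1,1)] by (intro finite_imageI finite_subset[OF sub]) simp
  show "k \<le> extremal (card X) - 2"
    if "k \<in> card ` {K. K \<subseteq> part_inj X X - {Map.empty, Some |` X} \<and> commuting K}" for k
    using that card_clique_le[OF assms(1,2)] by blast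
  show "extremal (card X) - 2 \<in>
      card ` {K. K \<subseteq> part_inj X X - {Map.empty, Some |` X} \<and> commuting K}"
    using assms(3) by (metis (mono_tags, lifting) image_eqI mem_Collect_eq)
qed

theorem corollary6p1:
  fixes X :: "'a set" and n m :: nat
  assumes "finite X" and "card X = n" and "n \<ge> 2" and "m = n div 2"
  shows "(n < 10 \<longrightarrow> clique_number (commuting_graph (sym_inv_semigroup X)) = 2 ^ n - 2) \<and>
    (n \<ge> 10 \<longrightarrow>
      clique_number (commuting_graph (sym_inv_semigroup X)) = lambda_num n - 1 \<and>
      lambda_num n - 1 = (\<Sum>r = 0..m. (m choose r) * ((n - m) choose r) * fact r) - 1)"
proof (intro conjI impI)
  have ne: "X \<noteq> {}" using assms by auto
  show "clique_number (commuting_graph (sym_inv_semigroup X)) = 2 ^ n - 2" if "n < 10"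
    using clique_number_eq[OF assms(1) ne] ex_idempotent_clique[OF assms(1) ne] that assms(2)
    by (simp add: extremal_def)
  show "clique_number (commuting_graph (sym_inv_semigroup X)) = lambda_num n - 1" if "n \<ge> 10"
    using clique_number_eq[OF assms(1) ne] ex_null_clique[OF assms(1,2,3)] that assms(2)
    by (simp add: extremal_def)
  show "lambda_num n - 1 = (\<Sum>r = 0..m. (m choose r) * ((n - m) choose r) * fact r) - 1"
    by (simp add: lambda_num_def Let_def assms(4))
qed

end
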